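(* The functors $\vee\colon (i\mathcal{I}_+)^{\mathrm{op}}\to i\Delta_+$ and $\wedge\colon (i\Delta_+)^{\mathrm{op}}\to i\mathcal{I}_+$ are mutually inverse isomorphisms of categories.
   Context: Ordinals and intervals. For $n\in\{-1,0,1,\dots\}$ let $[n]=\{0,\dots,n\}$ with its usual order ($[-1]=\emptyset$). $\Delta_+$ is the category of all $[n]$, $n\ge -1$, and order-preserving maps. $\mathcal{I}_+$ is the category whose objects (intervals) are the $[n]$ with $n\ge 0$ and whose morphisms are the order-preserving maps preserving the least and the greatest elements; these two elements are the endpoints of $[n]$ (they coincide for $[0]$). For $g\colon[m]\to[n]$ in $\Delta_+$ let $[m]^\wedge=[m+1]$ and let $g^\wedge\colon[n+1]\to[m+1]$ be the interval map $g^\wedge(j)=\min(\{i\in[m] : j\le g(i)\}\cup\{m+1\})$. For $f\colon[m]\to[n]$ in $\mathcal{I}_+$ let $[m]^\vee=[m-1]$ and let $f^\vee\colon[n-1]\to[m-1]$ be the order-preserving map $f^\vee(j)=\max\{i\in[m] : f(i)\le j\}$. These give mutually inverse isomorphisms $(-)^\vee\colon\mathcal{I}_+^{\mathrm{op}}\to\Delta_+$ and $(-)^\wedge\colon\Delta_+^{\mathrm{op}}\to\mathcal{I}_+$ (well known). The category $i\mathcal{I}_+$, defined inductively. The object of height $0$ is the interval $[0]$; it is called trivial (with $\mathrm{Ob}[0]=[0]$), and it is the only object whose underlying interval is $[0]$. For $n\ge1$, an object $H$ of height $n$ consists of an interval $\mathrm{Ob}\,H$ and, for each $i\in\mathrm{Ob}\,H$,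 an object $H(i)$ of height strictly less than $n$, such that $H(i)$ is trivial if and only if $i$ is an endpoint of $\mathrm{Ob}\,H$. For every object $H$ there is a unique morphism $H\to[0]$. For $K$ nontrivial, a morphism $g\colon H\to K$ consists of an interval map $g\colon\mathrm{Ob}\,H\to\mathrm{Ob}\,K$ and, for every $i\in\mathrm{Ob}\,H$, a morphism $g(i)\colon H(i)\to K(g i)$ (so there is none if $H$ is trivial). Composition: $(g\circ f)$ has object map the composite and $(g\circ f)(i)=g(f i)\circ f(i)$. The category $i\Delta_+$, defined inductively. The object of height $0$ is the ordinal $[-1]$; it is called trivial, and it is the only object whose underlying ordinal is $[-1]$. For $n\ge1$, an object $K$ of height $n$ consists of an ordinal $\mathrm{Ob}\,K$ and, for each $j\in(\mathrm{Ob}\,K)^\wedge$, an object $K(j)$ of height strictly less than $n$, such that $K(j)$ is trivial if and only if $j$ is an endpoint of $(\mathrm{Ob}\,K)^\wedge$. For every object $K$ there is a unique morphism $[-1]\to K$. For $H$ nontrivial, a morphism $g\colon H\to K$ consists of an order-preserving map $g\colon\mathrm{Ob}\,H\to\mathrm{Ob}\,K$ and, for every $j\in(\mathrm{Ob}\,K)^\wedge$, a morphism $g(j)\colon H(g^\wedge j)\to K(j)$ (so there is none if $K$ is trivial). Composition: the object map is the composite and $(g\circ f)(j)=g(j)\circ f(g^\wedge j)$. The functor $\vee$: it sends $[0]$ to $[-1]$; a nontrivial $H$ goes to the object with underlying ordinal $(\mathrm{Ob}\,H)^\vee$ and with $(\vee H)(i)=\vee(H(i))$ for $i\in((\mathrm{Ob}\,H)^\vee)^\wedge=\mathrm{Ob}\,H$;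 the morphism $H\to[0]$ goes to the unique morphism $[-1]\to\vee H$; any other morphism $g=(g,(g(i))_i)$ goes to $(g^\vee,(\vee g(i))_i)$. The functor $\wedge$ is defined in the same way: $[-1]\mapsto[0]$, $K\mapsto((\mathrm{Ob}\,K)^\wedge,(\wedge K(j))_j)$, the morphism $[-1]\to K$ goes to the unique morphism $\wedge K\to[0]$, and any other $g$ goes to $(g^\wedge,(\wedge g(j))_j)$. *)

theory Defs
  imports Main "HOL-Library.FuncSet"
begin

section \<open>Categories, opposites, functors\<close>

record ('o, 'a) cat =
  Obj :: "'o set"
  Arr :: "'a set"
  Dom :: "'a \<Rightarrow> 'o"
  Cod :: "'a \<Rightarrow> 'o"
  Ident :: "'o \<Rightarrow> 'a"
  Comp :: "'a \<Rightarrow> 'a \<Rightarrow> 'a"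

text \<open>\<open>Comp C g f\<close> is \<open>g\<close> after \<open>f\<close>; it is only meaningful if \<open>Dom C g = Cod C f\<close>.\<close>

definition is_category :: "('o, 'a) cat \<Rightarrow> bool" where
  "is_category C \<longleftrightarrow>
     (\<forall>f\<in>Arr C. Dom C f \<in> Obj C \<and> Cod C f \<in> Obj C) \<and>
     (\<forall>x\<in>Obj C. Ident C x \<in> Arr C \<and> Dom C (Ident C x) = x \<and> Cod C (Ident C x) = x) \<and>
     (\<forall>g\<in>Arr C. \<forall>f\<in>Arr C. Dom C g = Cod C f \<longrightarrow>
        Comp C g f \<in> Arr C \<and> Dom C (Comp C g f) = Dom C f \<and> Cod C (Comp C g f) = Cod C g) \<and>
     (\<forall>f\<in>Arr C. Comp C f (Ident C (Dom C f)) = f \<and> Comp C (Ident C (Cod C f)) f = f) \<and>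
     (\<forall>h\<in>Arr C. \<forall>g\<in>Arr C. \<forall>f\<in>Arr C. Dom C h = Cod C g \<longrightarrow> Dom C g = Cod C f \<longrightarrow>
        Comp C h (Comp C g f) = Comp C (Comp C h g) f)"

definition opposite :: "('o, 'a) cat \<Rightarrow> ('o, 'a) cat" where
  "opposite C = \<lparr>Obj = Obj C, Arr = Arr C, Dom = Cod C, Cod = Dom C,
     Ident = Ident C, Comp = (\<lambda>g f. Comp C f g)\<rparr>"

record ('o, 'a, 'p, 'b) fun_data =
  on_obj :: "'o \<Rightarrow> 'p"
  on_arr :: "'a \<Rightarrow> 'b"

definition is_functor ::
  "('o, 'a) cat \<Rightarrow> ('p, 'b) cat \<Rightarrow> ('o, 'a, 'p, 'b) fun_data \<Rightarrow> bool" where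
  "is_functor C D F \<longleftrightarrow> is_category C \<and> is_category D \<and>
     (\<forall>x\<in>Obj C. on_obj F x \<in> Obj D) \<and>
     (\<forall>f\<in>Arr C. on_arr F f \<in> Arr D \<and>
        Dom D (on_arr F f) = on_obj F (Dom C f) \<and> Cod D (on_arr F f) = on_obj F (Cod C f)) \<and>
     (\<forall>x\<in>Obj C. on_arr F (Ident C x) = Ident D (on_obj F x)) \<and>
     (\<forall>g\<in>Arr C. \<forall>f\<in>Arr C. Dom C g = Cod C f \<longrightarrow>
        on_arr F (Comp C g f) = Comp D (on_arr F g) (on_arr F f))"

definition inverse_isomorphisms ::
  "('o, 'a) cat \<Rightarrow> ('p, 'b) cat \<Rightarrow> ('o, 'a, 'p, 'b) fun_data \<Rightarrow> ('p, 'b, 'o, 'a) fun_data \<Rightarrow> bool"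
where
  "inverse_isomorphisms C D F G \<longleftrightarrow> is_functor C D F \<and> is_functor D C G \<and>
     (\<forall>x\<in>Obj C. on_obj G (on_obj F x) = x) \<and> (\<forall>f\<in>Arr C. on_arr G (on_arr F f) = f) \<and>
     (\<forall>y\<in>Obj D. on_obj F (on_obj G y) = y) \<and> (\<forall>g\<in>Arr D. on_arr F (on_arr G g) = g)"


section \<open>Ordinals and intervals\<close>

text \<open>
  The ordinal \<open>[n]\<close>, \<open>n \<ge> -1\<close>, is the set \<open>{0..n}\<close> of integers, represented by the integer
  \<open>n\<close>. Maps out of \<open>[m]\<close> are extensional functions (\<open>undefined\<close> outside \<open>{0..m}\<close>), so that
  HOL equality of functions is equality of maps.
\<close>

definition ordinal_maps :: "int \<Rightarrow> int \<Rightarrow> (int \<Rightarrow> int) set" where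
  "ordinal_maps m n = {g \<in> {0..m} \<rightarrow>\<^sub>E {0..n}. mono_on {0..m} g}"

definition interval_maps :: "int \<Rightarrow> int \<Rightarrow> (int \<Rightarrow> int) set" where
  "interval_maps m n = {f \<in> ordinal_maps m n. f 0 = 0 \<and> f m = n}"

text \<open>\<open>wedge_map m n g\<close> and \<open>vee_map m n f\<close> are the duals of \<open>g\<close>, \<open>f : [m] \<rightarrow> [n]\<close>.\<close>

definition wedge_map :: "int \<Rightarrow> int \<Rightarrow> (int \<Rightarrow> int) \<Rightarrow> (int \<Rightarrow> int)" where
  "wedge_map m n g = (\<lambda>j\<in>{0..n + 1}. Min ({i \<in> {0..m}. j \<le> g i} \<union> {m + 1}))"

definition vee_map :: "int \<Rightarrow> int \<Rightarrow> (int \<Rightarrow> int) \<Rightarrow> (int \<Rightarrow> int)" where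
  "vee_map m n f = (\<lambda>j\<in>{0..n - 1}. Max {i \<in> {0..m}. f i \<le> j})"


section \<open>The category of iterated intervals\<close>

text \<open>
  \<open>INode m H\<close> is the nontrivial object with underlying interval \<open>[m]\<close> and components \<open>H i\<close>
  for \<open>i \<in> {0..m}\<close>. The condition \<open>1 \<le> m\<close> below expresses that the trivial object is the only
  one with underlying interval \<open>[0]\<close>.
\<close>

datatype iint = ITriv | INode int "int \<Rightarrow> iint"

primrec iI_under :: "iint \<Rightarrow> int" where
  "iI_under ITriv = 0"
| "iI_under (INode m H) = m"

inductive iI_height :: "nat \<Rightarrow> iint \<Rightarrow> bool" where
  triv: "iI_height 0 ITriv"
| node: "\<lbrakk>1 \<le> n; 1 \<le> m; H \<in> extensional {0..m};
    \<forall>i\<in>{0..m}. \<exists>k<n. iI_height k (H i);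
    \<forall>i\<in>{0..m}. H i = ITriv \<longleftrightarrow> i = 0 \<or> i = m\<rbrakk>
    \<Longrightarrow> iI_height n (INode m H)"

definition iI_obj :: "iint set" where
  "iI_obj = {H. \<exists>n. iI_height n H}"

text \<open>
  Morphisms carry their domain and codomain: \<open>IBang H\<close> is the unique morphism from \<open>H\<close> to the
  trivial object, and \<open>IMor H K g gs\<close> is the morphism \<open>H \<rightarrow> K\<close> with object map \<open>g\<close> and
  components \<open>gs i\<close> for \<open>i \<in> Ob H\<close>.
\<close>

datatype imor = IBang iint | IMor iint iint "int \<Rightarrow> int" "int \<Rightarrow> imor"

primrec iI_dom :: "imor \<Rightarrow> iint" where
  "iI_dom (IBang H) = H"
| "iI_dom (IMor H K g gs) = H"

primrec iI_cod :: "imor \<Rightarrow> iint" where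
  "iI_cod (IBang H) = ITriv"
| "iI_cod (IMor H K g gs) = K"

inductive iI_hom :: "iint \<Rightarrow> iint \<Rightarrow> imor \<Rightarrow> bool" where
  bang: "H \<in> iI_obj \<Longrightarrow> iI_hom H ITriv (IBang H)"
| mor: "\<lbrakk>INode m H \<in> iI_obj; INode n K \<in> iI_obj; g \<in> interval_maps m n;
    gs \<in> extensional {0..m}; \<forall>i\<in>{0..m}. iI_hom (H i) (K (g i)) (gs i)\<rbrakk>
    \<Longrightarrow> iI_hom (INode m H) (INode n K) (IMor (INode m H) (INode n K) g gs)"

primrec iI_id :: "iint \<Rightarrow> imor" where
  "iI_id ITriv = IBang ITriv"
| "iI_id (INode m H) =
     IMor (INode m H) (INode m H) (\<lambda>i\<in>{0..m}. i) (\<lambda>i\<in>{0..m}. iI_id (H i))"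

text \<open>
  In the second equation the codomain of the first factor \<open>f\<close> is nontrivial, so the case
  \<open>IBang\<close> is junk.
\<close>

primrec iI_comp :: "imor \<Rightarrow> imor \<Rightarrow> imor" where
  "iI_comp (IBang K) f = IBang (iI_dom f)"
| "iI_comp (IMor K L g gs) f = (case f of
      IBang H \<Rightarrow> undefined
    | IMor H K' f' fs \<Rightarrow> IMor H L (compose {0..iI_under H} g f')
        (\<lambda>i\<in>{0..iI_under H}. iI_comp (gs (f' i)) (fs i)))"

definition iI_cat :: "(iint, imor) cat" where
  "iI_cat = \<lparr>Obj = iI_obj, Arr = {f. \<exists>H K. iI_hom H K f}, Dom = iI_dom, Cod = iI_cod,
     Ident = iI_id, Comp = iI_comp\<rparr>"


section \<open>The category of iterated ordinals\<close>

text \<open>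
  \<open>DNode m K\<close> is the nontrivial object with underlying ordinal \<open>[m]\<close> and components \<open>K j\<close>
  for \<open>j\<close> in the dual interval \<open>{0..m + 1}\<close>; here \<open>0 \<le> m\<close>, since only the trivial object has
  underlying ordinal \<open>[-1]\<close>.
\<close>

datatype iord = DTriv | DNode int "int \<Rightarrow> iord"

primrec iD_under :: "iord \<Rightarrow> int" where
  "iD_under DTriv = -1"
| "iD_under (DNode m K) = m"

inductive iD_height :: "nat \<Rightarrow> iord \<Rightarrow> bool" where
  triv: "iD_height 0 DTriv"
| node: "\<lbrakk>1 \<le> n; 0 \<le> m; K \<in> extensional {0..m + 1};
    \<forall>j\<in>{0..m + 1}. \<exists>k<n. iD_height k (K j);
    \<forall>j\<in>{0..m + 1}. K j = DTriv \<longleftrightarrow> j = 0 \<or> j = m + 1\<rbrakk>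
    \<Longrightarrow> iD_height n (DNode m K)"

definition iD_obj :: "iord set" where
  "iD_obj = {K. \<exists>n. iD_height n K}"

text \<open>
  \<open>DBang K\<close> is the unique morphism from the trivial object to \<open>K\<close>, and \<open>DMor H K g gs\<close> is the
  morphism \<open>H \<rightarrow> K\<close> with object map \<open>g\<close> and components \<open>gs j\<close> for \<open>j\<close> in the dual interval of
  the ordinal underlying \<open>K\<close>.
\<close>

datatype dmor = DBang iord | DMor iord iord "int \<Rightarrow> int" "int \<Rightarrow> dmor"

primrec iD_dom :: "dmor \<Rightarrow> iord" where
  "iD_dom (DBang K) = DTriv"
| "iD_dom (DMor H K g gs) = H"

primrec iD_cod :: "dmor \<Rightarrow> iord" where
  "iD_cod (DBang K) = K"
| "iD_cod (DMor H K g gs) = K"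

inductive iD_hom :: "iord \<Rightarrow> iord \<Rightarrow> dmor \<Rightarrow> bool" where
  bang: "K \<in> iD_obj \<Longrightarrow> iD_hom DTriv K (DBang K)"
| mor: "\<lbrakk>DNode m H \<in> iD_obj; DNode n K \<in> iD_obj; g \<in> ordinal_maps m n;
    gs \<in> extensional {0..n + 1};
    \<forall>j\<in>{0..n + 1}. iD_hom (H (wedge_map m n g j)) (K j) (gs j)\<rbrakk>
    \<Longrightarrow> iD_hom (DNode m H) (DNode n K) (DMor (DNode m H) (DNode n K) g gs)"

primrec iD_id :: "iord \<Rightarrow> dmor" where
  "iD_id DTriv = DBang DTriv"
| "iD_id (DNode m K) =
     DMor (DNode m K) (DNode m K) (\<lambda>i\<in>{0..m}. i) (\<lambda>j\<in>{0..m + 1}. iD_id (K j))"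

text \<open>
  The first equation concerns composites \<open>[-1] \<rightarrow> [-1] \<rightarrow> K\<close>, the case \<open>DBang\<close> of the second
  one composites \<open>[-1] \<rightarrow> K \<rightarrow> L\<close>.
\<close>

primrec iD_comp :: "dmor \<Rightarrow> dmor \<Rightarrow> dmor" where
  "iD_comp (DBang K) f = DBang K"
| "iD_comp (DMor K L g gs) f = (case f of
      DBang K' \<Rightarrow> DBang L
    | DMor H K' f' fs \<Rightarrow> DMor H L (compose {0..iD_under H} g f')
        (\<lambda>j\<in>{0..iD_under L + 1}.
           iD_comp (gs j) (fs (wedge_map (iD_under K) (iD_under L) g j))))"

definition iD_cat :: "(iord, dmor) cat" where
  "iD_cat = \<lparr>Obj = iD_obj, Arr = {f. \<exists>H K. iD_hom H K f}, Dom = iD_dom, Cod = iD_cod,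
     Ident = iD_id, Comp = iD_comp\<rparr>"


section \<open>The functors\<close>

primrec vee_obj :: "iint \<Rightarrow> iord" where
  "vee_obj ITriv = DTriv"
| "vee_obj (INode m H) = DNode (m - 1) (\<lambda>i\<in>{0..m}. vee_obj (H i))"

primrec vee_arr :: "imor \<Rightarrow> dmor" where
  "vee_arr (IBang H) = DBang (vee_obj H)"
| "vee_arr (IMor H K g gs) =
     DMor (vee_obj K) (vee_obj H) (vee_map (iI_under H) (iI_under K) g)
       (\<lambda>i\<in>{0..iI_under H}. vee_arr (gs i))"

definition vee :: "(iint, imor, iord, dmor) fun_data" where
  "vee = \<lparr>on_obj = vee_obj, on_arr = vee_arr\<rparr>"

primrec wedge_obj :: "iord \<Rightarrow> iint" where
  "wedge_obj DTriv = ITriv"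
| "wedge_obj (DNode m K) = INode (m + 1) (\<lambda>j\<in>{0..m + 1}. wedge_obj (K j))"

primrec wedge_arr :: "dmor \<Rightarrow> imor" where
  "wedge_arr (DBang K) = IBang (wedge_obj K)"
| "wedge_arr (DMor H K g gs) =
     IMor (wedge_obj K) (wedge_obj H) (wedge_map (iD_under H) (iD_under K) g)
       (\<lambda>j\<in>{0..iD_under K + 1}. wedge_arr (gs j))"

definition wedge :: "(iord, dmor, iint, imor) fun_data" where
  "wedge = \<lparr>on_obj = wedge_obj, on_arr = wedge_arr\<rparr>"

text \<open>
  A functor \<open>C\<^sup>o\<^sup>p \<rightarrow> D\<close> and its opposite \<open>C \<rightarrow> D\<^sup>o\<^sup>p\<close> have the same underlying data. Hence in
  \<open>inverse_isomorphisms (opposite iI_cat) iD_cat vee wedge\<close> the last argument, as a functor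
  from \<open>iD_cat\<close> to \<open>opposite iI_cat\<close>, is the opposite of \<open>wedge\<close> on \<open>opposite iD_cat\<close>.
\<close>

end

theory Submission
  imports Defs
begin

text \<open>
  For a monotone map \<open>g : [m] \<rightarrow> [n]\<close> the dual \<open>g\<^sup>\<and>\<close> is a left adjoint of \<open>g\<close>, in the sense that
  \<open>g\<^sup>\<and> j \<le> i \<longleftrightarrow> j \<le> g i\<close>; for an interval map \<open>f\<close> the dual \<open>f\<^sup>\<or>\<close> is a right adjoint,
  \<open>i \<le> f\<^sup>\<or> j \<longleftrightarrow> f i \<le> j\<close> (lemmas \<open>wedge_map_le_iff\<close> and \<open>le_vee_map_iff\<close>). An
  element of a finite chain is determined by the set of elements above it, or below it, so
  adjoints are unique. Uniqueness gives that the two dualities of maps are mutually inverse and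
  that \<open>f \<mapsto> f\<^sup>\<or>\<close> reverses composition.

  The iterated statement is then proved by induction. A component of a morphism \<open>f : H \<rightarrow> K\<close> at
  \<open>i\<close> goes from \<open>H i\<close> to \<open>K (f i)\<close>; a component of its dual at \<open>i\<close> has to start at the
  component of \<open>\<or>K\<close> with index \<open>(f\<^sup>\<or>)\<^sup>\<and> i\<close>, and this index is \<open>f i\<close>. So the same index set and
  the same pairs of indices occur on both sides, and each claim about \<open>\<or>\<close> or \<open>\<and>\<close> reduces to the
  same claim about components together with a fact about maps.

  The category laws are checked by hand only for iterated intervals. Since \<open>\<or>\<close> is a bijection
  on objects and arrows, with inverse \<open>\<and>\<close>, that commutes with all the structure, the laws for
  iterated ordinals and the functoriality of \<open>\<and>\<close> follow by transport of structure (lemma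
  \<open>inverse_isomorphisms_by_transport\<close>).
\<close>

section \<open>Isomorphisms of categories\<close>

text \<open>
  If \<open>F\<close> is a structure-preserving bijection with inverse \<open>G\<close>, every arrow and object of \<open>D\<close> is
  an \<open>F\<close>-image, so each law of \<open>D\<close> is the image of the corresponding law of \<open>C\<close>.
\<close>

lemma inverse_isomorphisms_by_transport:
  assumes C: "is_category C"
    and obj: "\<And>x. x \<in> Obj C \<Longrightarrow> on_obj F x \<in> Obj D \<and> on_obj G (on_obj F x) = x"
    and obj': "\<And>y. y \<in> Obj D \<Longrightarrow> on_obj G y \<in> Obj C \<and> on_obj F (on_obj G y) = y"
    and arr: "\<And>f. f \<in> Arr C \<Longrightarrow> on_arr F f \<in> Arr D \<and> on_arr G (on_arr F f) = f"
    and arr': "\<And>g. g \<in> Arr D \<Longrightarrow> on_arr G g \<in> Arr C \<and> on_arr F (on_arr G g) = g"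
    and dom: "\<And>f. f \<in> Arr C \<Longrightarrow> Dom D (on_arr F f) = on_obj F (Dom C f)"
    and cod: "\<And>f. f \<in> Arr C \<Longrightarrow> Cod D (on_arr F f) = on_obj F (Cod C f)"
    and ident: "\<And>x. x \<in> Obj C \<Longrightarrow> on_arr F (Ident C x) = Ident D (on_obj F x)"
    and comp: "\<And>g f. \<lbrakk>g \<in> Arr C; f \<in> Arr C; Dom C g = Cod C f\<rbrakk> \<Longrightarrow>
                 on_arr F (Comp C g f) = Comp D (on_arr F g) (on_arr F f)"
  shows "inverse_isomorphisms C D F G"
proof -
  have ends: "Dom C f \<in> Obj C" "Cod C f \<in> Obj C" if "f \<in> Arr C" for f
    using C that unfolding is_category_def by blast+
  have id_arr: "Ident C x \<in> Arr C" "Dom C (Ident C x) = x" "Cod C (Ident C x) = x"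
    if "x \<in> Obj C" for x
    using C that unfolding is_category_def by blast+
  have comp_arr: "Comp C g f \<in> Arr C" "Dom C (Comp C g f) = Dom C f"
    "Cod C (Comp C g f) = Cod C g"
    if "g \<in> Arr C" "f \<in> Arr C" "Dom C g = Cod C f" for g f
    using C that unfolding is_category_def by blast+
  have unit: "Comp C f (Ident C (Dom C f)) = f" "Comp C (Ident C (Cod C f)) f = f"
    if "f \<in> Arr C" for f
    using C that unfolding is_category_def by blast+
  have assoc: "Comp C h (Comp C g f) = Comp C (Comp C h g) f"
    if "h \<in> Arr C" "g \<in> Arr C" "f \<in> Arr C" "Dom C h = Cod C g" "Dom C g = Cod C f" for h g f
    using C that unfolding is_category_def by blast
  have objE: "\<exists>x\<in>Obj C. y = on_obj F x" if "y \<in> Obj D" for y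
    using obj'[OF that] by metis
  have arrE: "\<exists>f\<in>Arr C. g = on_arr F f" if "g \<in> Arr D" for g
    using arr'[OF that] by metis
  have obj_inj: "x = y" if "on_obj F x = on_obj F y" "x \<in> Obj C" "y \<in> Obj C" for x y
    using obj that by metis
  have composable: "Dom C g = Cod C f"
    if "Dom D (on_arr F g) = Cod D (on_arr F f)" "g \<in> Arr C" "f \<in> Arr C" for g f
    using that by (metis obj_inj dom cod ends)
  have D1: "Dom D f \<in> Obj D \<and> Cod D f \<in> Obj D" if "f \<in> Arr D" for f
    using arrE[OF that] obj ends dom cod by auto
  have D2: "Ident D x \<in> Arr D \<and> Dom D (Ident D x) = x \<and> Cod D (Ident D x) = x"
    if "x \<in> Obj D" for x
    using objE[OF that] id_arr arr dom cod ident by metis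
  have D3: "Comp D g f \<in> Arr D \<and> Dom D (Comp D g f) = Dom D f \<and> Cod D (Comp D g f) = Cod D g"
    if "g \<in> Arr D" "f \<in> Arr D" "Dom D g = Cod D f" for g f
  proof -
    obtain g' f' where "g' \<in> Arr C" "g = on_arr F g'" "f' \<in> Arr C" "f = on_arr F f'"
      using arrE \<open>g \<in> Arr D\<close> \<open>f \<in> Arr D\<close> by blast
    with that composable show ?thesis by (metis comp comp_arr arr dom cod)
  qed
  have D4: "Comp D f (Ident D (Dom D f)) = f \<and> Comp D (Ident D (Cod D f)) f = f"
    if "f \<in> Arr D" for f
  proof -
    obtain f' where "f' \<in> Arr C" "f = on_arr F f'" using arrE[OF \<open>f \<in> Arr D\<close>] by blast
    then show ?thesis by (metis comp ident id_arr unit dom cod ends)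
  qed
  have D5: "Comp D h (Comp D g f) = Comp D (Comp D h g) f"
    if "h \<in> Arr D" "g \<in> Arr D" "f \<in> Arr D" "Dom D h = Cod D g" "Dom D g = Cod D f" for h g f
  proof -
    obtain h' g' f' where *: "h' \<in> Arr C" "h = on_arr F h'" "g' \<in> Arr C" "g = on_arr F g'"
      "f' \<in> Arr C" "f = on_arr F f'"
      using arrE \<open>h \<in> Arr D\<close> \<open>g \<in> Arr D\<close> \<open>f \<in> Arr D\<close> by metis
    then have c: "Dom C h' = Cod C g'" "Dom C g' = Cod C f'"
      using that composable by auto
    have "Comp D h (Comp D g f) = on_arr F (Comp C h' (Comp C g' f'))"
      using * c by (simp add: comp comp_arr)
    also have "\<dots> = on_arr F (Comp C (Comp C h' g') f')" using * c by (simp add: assoc)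
    also have "\<dots> = Comp D (Comp D h g) f" using * c by (simp add: comp comp_arr)
    finally show ?thesis .
  qed
  have D: "is_category D"
    unfolding is_category_def using D1 D2 D3 D4 D5 by blast
  have G_ends: "Dom C (on_arr G g) = on_obj G (Dom D g) \<and> Cod C (on_arr G g) = on_obj G (Cod D g)"
    if "g \<in> Arr D" for g
    using arr'[OF that] by (metis dom cod obj ends)
  have G_ident: "on_arr G (Ident D y) = Ident C (on_obj G y)" if "y \<in> Obj D" for y
    using obj'[OF that] by (metis ident arr id_arr(1))
  have G_comp: "on_arr G (Comp D g f) = Comp C (on_arr G g) (on_arr G f)"
    if "g \<in> Arr D" "f \<in> Arr D" "Dom D g = Cod D f" for g f
    using arr'[OF that(1)] arr'[OF that(2)] that(3) by (metis comp comp_arr(1) arr composable)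
  have F: "is_functor C D F"
    unfolding is_functor_def using C D obj arr dom cod ident comp by simp
  have G: "is_functor D C G"
    unfolding is_functor_def using C D obj' arr' G_ends G_ident G_comp by simp
  show ?thesis
    unfolding inverse_isomorphisms_def using F G obj obj' arr arr' by simp
qed

lemma opposite_opposite: "opposite (opposite C) = (C :: ('o, 'a) cat)"
  by (simp add: opposite_def)

lemma is_category_opposite:
  assumes "is_category C"
  shows "is_category (opposite C)"
  using assms unfolding is_category_def opposite_def by simp

lemma is_functor_opposite:
  assumes "is_functor C D F"
  shows "is_functor (opposite C) (opposite D) F"
  using assms is_category_opposite[of C] is_category_opposite[of D]
  unfolding is_functor_def by (simp add: opposite_def)

lemma inverse_isomorphisms_opposite:
  fixes C :: "('o, 'a) cat"
  assumes "inverse_isomorphisms (opposite C) D F G"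
  shows "inverse_isomorphisms (opposite D) C G F"
  using assms is_functor_opposite[of "opposite C" D F] is_functor_opposite[of D "opposite C" G]
  unfolding inverse_isomorphisms_def by (simp add: opposite_opposite) (simp add: opposite_def)


section \<open>Duality of ordinals and intervals\<close>

lemma ordinal_mapsD:
  assumes "g \<in> ordinal_maps m n"
  shows "i \<in> {0..m} \<Longrightarrow> g i \<in> {0..n}"
    and "i \<in> {0..m} \<Longrightarrow> j \<in> {0..m} \<Longrightarrow> i \<le> j \<Longrightarrow> g i \<le> g j"
    and "g \<in> extensional {0..m}"
  using assms unfolding ordinal_maps_def by (auto simp: PiE_def intro: mono_onD)

lemma ordinal_mapsI:
  assumes "\<And>i. i \<in> {0..m} \<Longrightarrow> g i \<in> {0..n}"
    and "\<And>i j. \<lbrakk>i \<in> {0..m}; j \<in> {0..m}; i \<le> j\<rbrakk> \<Longrightarrow> g i \<le> g j"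
    and "g \<in> extensional {0..m}"
  shows "g \<in> ordinal_maps m n"
  using assms unfolding ordinal_maps_def by (auto intro: mono_onI simp: PiE_def)

lemma interval_mapsD:
  assumes "f \<in> interval_maps m n"
  shows "f \<in> ordinal_maps m n" "f 0 = 0" "f m = n"
  using assms unfolding interval_maps_def by auto

lemma wedge_map_le_iff:
  assumes g: "g \<in> ordinal_maps m n" and i: "i \<in> {0..m}" and j: "j \<in> {0..n + 1}"
  shows "wedge_map m n g j \<le> i \<longleftrightarrow> j \<le> g i"
proof -
  have fin: "finite {k \<in> {0..m}. j \<le> g k}" by (rule finite_Collect_conjI) simp
  have "wedge_map m n g j \<le> i \<longleftrightarrow> (\<exists>k\<in>{k \<in> {0..m}. j \<le> g k} \<union> {m + 1}. k \<le> i)"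
    unfolding wedge_map_def restrict_apply'[OF j] using fin by (subst Min_le_iff) auto
  also have "\<dots> \<longleftrightarrow> j \<le> g i"
    using i ordinal_mapsD(2)[OF g _ i] by force
  finally show ?thesis .
qed

lemma wedge_map_range:
  assumes "0 \<le> m" "j \<in> {0..n + 1}"
  shows "wedge_map m n g j \<in> {0..m + 1}"
proof -
  let ?S = "{i \<in> {0..m}. j \<le> g i} \<union> {m + 1}"
  have "finite {i \<in> {0..m}. j \<le> g i}" by (rule finite_Collect_conjI) simp
  then have "Min ?S \<in> ?S" by (intro Min_in) auto
  with assms show ?thesis unfolding wedge_map_def by auto
qed

lemma le_vee_map_iff:
  assumes f: "f \<in> interval_maps m n" and i: "i \<in> {0..m}" and j: "j \<in> {0..n - 1}"
  shows "i \<le> vee_map m n f j \<longleftrightarrow> f i \<le> j"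
proof -
  note f' = interval_mapsD[OF f]
  have fin: "finite {k \<in> {0..m}. f k \<le> j}" by (rule finite_Collect_conjI) simp
  \<comment> \<open>the maximum is over a nonempty set because \<open>f 0 = 0\<close>\<close>
  have "i \<le> vee_map m n f j \<longleftrightarrow> (\<exists>k\<in>{k \<in> {0..m}. f k \<le> j}. i \<le> k)"
    unfolding vee_map_def restrict_apply'[OF j] using i j f'(2) fin
    by (subst Max_ge_iff) (auto intro!: exI[of _ 0])
  also have "\<dots> \<longleftrightarrow> f i \<le> j"
    using i ordinal_mapsD(2)[OF f'(1) i] by force
  finally show ?thesis .
qed

lemma vee_map_range:
  assumes f: "f \<in> interval_maps m n" and "0 \<le> m" and j: "j \<in> {0..n - 1}"
  shows "vee_map m n f j \<in> {0..m - 1}"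
proof -
  let ?S = "{i \<in> {0..m}. f i \<le> j}"
  note f' = interval_mapsD[OF f]
  have "finite ?S" by (rule finite_Collect_conjI) simp
  moreover have "0 \<in> ?S" using assms f' by auto
  ultimately have "Max ?S \<in> ?S" by (intro Max_in) auto
  \<comment> \<open>the maximum is not \<open>m\<close> because \<open>f m = n > j\<close>\<close>
  then have "Max ?S \<in> {0..m - 1}" using j f'(3) by (cases "Max ?S = m") auto
  with j show ?thesis unfolding vee_map_def by auto
qed

lemma eq_if_same_upper_bounds:
  fixes a b m :: int
  assumes "a \<in> {0..m + 1}" "b \<in> {0..m + 1}" "\<And>i. i \<in> {0..m} \<Longrightarrow> a \<le> i \<longleftrightarrow> b \<le> i"
  shows "a = b"
  using assms(1,2) assms(3)[of a] assms(3)[of b] by force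

lemma eq_if_same_lower_bounds:
  fixes a b m :: int
  assumes "a \<in> {0..m}" "b \<in> {0..m}" "\<And>i. i \<in> {0..m} \<Longrightarrow> i \<le> a \<longleftrightarrow> i \<le> b"
  shows "a = b"
  using assms(1,2) assms(3)[of a] assms(3)[of b] by auto

lemma wedge_map_in_interval_maps:
  assumes g: "g \<in> ordinal_maps m n" and mn: "0 \<le> m" "0 \<le> n"
  shows "wedge_map m n g \<in> interval_maps (n + 1) (m + 1)"
proof -
  note r = wedge_map_range[OF mn(1), of _ n g] and adj = wedge_map_le_iff[OF g]
  have "wedge_map m n g i \<le> wedge_map m n g j"
    if "i \<in> {0..n + 1}" "j \<in> {0..n + 1}" "i \<le> j" for i j
  proof (cases "wedge_map m n g j = m + 1")
    case True
    then show ?thesis using r[OF that(1)] by simp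
  next
    case False
    \<comment> \<open>then \<open>k = wedge_map m n g j\<close> lies in \<open>[m]\<close>, and \<open>i \<le> j \<le> g k\<close>\<close>
    then have k: "wedge_map m n g j \<in> {0..m}" using r[OF that(2)] by auto
    with adj[OF k that(2)] adj[OF k that(1)] that(3) show ?thesis by auto
  qed
  moreover have "wedge_map m n g 0 = 0"
    using adj[of 0 0] r[of 0] mn ordinal_mapsD(1)[OF g, of 0] by force
  moreover have "wedge_map m n g (n + 1) = m + 1"
    using adj[of m "n + 1"] r[of "n + 1"] mn ordinal_mapsD(1)[OF g, of m] by force
  ultimately show ?thesis
    unfolding interval_maps_def using r by (auto intro!: ordinal_mapsI simp: wedge_map_def)
qed

lemma vee_map_in_ordinal_maps:
  assumes f: "f \<in> interval_maps m n" and m: "0 \<le> m"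
  shows "vee_map m n f \<in> ordinal_maps (n - 1) (m - 1)"
proof (rule ordinal_mapsI)
  note r = vee_map_range[OF f m] and adj = le_vee_map_iff[OF f]
  show "vee_map m n f j \<in> {0..m - 1}" if "j \<in> {0..n - 1}" for j
    using r[OF that] .
  show "vee_map m n f i \<le> vee_map m n f j"
    if "i \<in> {0..n - 1}" "j \<in> {0..n - 1}" "i \<le> j" for i j
  proof -
    have "vee_map m n f i \<in> {0..m}" using r[OF that(1)] by auto
    from adj[OF this that(1)] adj[OF this that(2)] that(3) show ?thesis by auto
  qed
  show "vee_map m n f \<in> extensional {0..n - 1}"
    by (simp add: vee_map_def)
qed

lemma wedge_vee_map:
  assumes f: "f \<in> interval_maps m n" and mn: "1 \<le> m" "1 \<le> n"
  shows "wedge_map (n - 1) (m - 1) (vee_map m n f) = f"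
proof (rule extensionalityI[of _ "{0..m}"])
  note f' = interval_mapsD[OF f]
  have v: "vee_map m n f \<in> ordinal_maps (n - 1) (m - 1)"
    using vee_map_in_ordinal_maps[OF f] mn by simp
  show "wedge_map (n - 1) (m - 1) (vee_map m n f) j = f j" if j: "j \<in> {0..m}" for j
  proof (rule eq_if_same_upper_bounds)
    show "wedge_map (n - 1) (m - 1) (vee_map m n f) j \<in> {0..n - 1 + 1}"
      using wedge_map_range[of "n - 1" j "m - 1"] j mn by simp
    show "f j \<in> {0..n - 1 + 1}" using ordinal_mapsD(1)[OF f'(1) j] by simp
    show "wedge_map (n - 1) (m - 1) (vee_map m n f) j \<le> i \<longleftrightarrow> f j \<le> i"
      if i: "i \<in> {0..n - 1}" for i
      using wedge_map_le_iff[OF v i, of j] le_vee_map_iff[OF f j i] j by simp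
  qed
qed (use ordinal_mapsD(3)[OF interval_mapsD(1)[OF f]] in \<open>auto simp: wedge_map_def\<close>)

lemma vee_wedge_map:
  assumes g: "g \<in> ordinal_maps m n" and mn: "0 \<le> m" "0 \<le> n"
  shows "vee_map (n + 1) (m + 1) (wedge_map m n g) = g"
proof (rule extensionalityI[of _ "{0..m}"])
  have w: "wedge_map m n g \<in> interval_maps (n + 1) (m + 1)"
    using wedge_map_in_interval_maps[OF g mn] .
  show "vee_map (n + 1) (m + 1) (wedge_map m n g) i = g i" if i: "i \<in> {0..m}" for i
  proof (rule eq_if_same_lower_bounds)
    show "vee_map (n + 1) (m + 1) (wedge_map m n g) i \<in> {0..n}"
      using vee_map_range[OF w, of i] i mn by simp
    show "g i \<in> {0..n}" using ordinal_mapsD(1)[OF g i] .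
    show "j \<le> vee_map (n + 1) (m + 1) (wedge_map m n g) i \<longleftrightarrow> j \<le> g i"
      if j: "j \<in> {0..n}" for j
      using le_vee_map_iff[OF w, of j i] wedge_map_le_iff[OF g i, of j] i j by simp
  qed
qed (use ordinal_mapsD(3)[OF g] in \<open>auto simp: vee_map_def\<close>)

lemma id_in_interval_maps: "0 \<le> m \<Longrightarrow> (\<lambda>i\<in>{0..m}. i) \<in> interval_maps m m"
  unfolding interval_maps_def by (auto intro!: ordinal_mapsI)

lemma compose_in_interval_maps:
  assumes f: "f \<in> interval_maps l m" and g: "g \<in> interval_maps m n" and l: "0 \<le> l"
  shows "compose {0..l} g f \<in> interval_maps l n"
proof -
  note f' = interval_mapsD[OF f] and g' = interval_mapsD[OF g]
  note f'' = ordinal_mapsD[OF f'(1)] and g'' = ordinal_mapsD[OF g'(1)]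
  have "compose {0..l} g f \<in> ordinal_maps l n"
  proof (rule ordinal_mapsI)
    show "compose {0..l} g f i \<in> {0..n}" if "i \<in> {0..l}" for i
      using g''(1)[OF f''(1)[OF that]] that by (simp only: compose_eq)
    show "compose {0..l} g f i \<le> compose {0..l} g f j"
      if "i \<in> {0..l}" "j \<in> {0..l}" "i \<le> j" for i j
      using g''(2)[OF f''(1) f''(1) f''(2)] that by (simp only: compose_eq)
  qed simp
  then show ?thesis
    unfolding interval_maps_def using f' g' l by (simp add: compose_def)
qed

lemma vee_map_id:
  assumes "0 \<le> m"
  shows "vee_map m m (\<lambda>i\<in>{0..m}. i) = (\<lambda>i\<in>{0..m - 1}. i)"
proof (rule extensionalityI[of _ "{0..m - 1}"])
  note i = id_in_interval_maps[OF assms]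
  show "vee_map m m (\<lambda>i\<in>{0..m}. i) j = (\<lambda>i\<in>{0..m - 1}. i) j" if j: "j \<in> {0..m - 1}" for j
  proof (rule eq_if_same_lower_bounds)
    show "vee_map m m (\<lambda>i\<in>{0..m}. i) j \<in> {0..m - 1}" using vee_map_range[OF i assms j] .
    show "(\<lambda>i\<in>{0..m - 1}. i) j \<in> {0..m - 1}" using j by simp
    show "k \<le> vee_map m m (\<lambda>i\<in>{0..m}. i) j \<longleftrightarrow> k \<le> (\<lambda>i\<in>{0..m - 1}. i) j"
      if "k \<in> {0..m - 1}" for k
      using le_vee_map_iff[OF i _ j, of k] that j by simp
  qed
qed (auto simp: vee_map_def)

lemma vee_map_compose:
  assumes f: "f \<in> interval_maps l m" and g: "g \<in> interval_maps m n" and lm: "0 \<le> l" "0 \<le> m"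
  shows "vee_map l n (compose {0..l} g f) = compose {0..n - 1} (vee_map l m f) (vee_map m n g)"
proof (rule extensionalityI[of _ "{0..n - 1}"])
  note gf = compose_in_interval_maps[OF f g lm(1)]
  show "vee_map l n (compose {0..l} g f) j = compose {0..n - 1} (vee_map l m f) (vee_map m n g) j"
    if j: "j \<in> {0..n - 1}" for j
  proof (rule eq_if_same_lower_bounds)
    note vg = vee_map_range[OF g lm(2) j]
    show "vee_map l n (compose {0..l} g f) j \<in> {0..l - 1}"
      using vee_map_range[OF gf lm(1) j] .
    show "compose {0..n - 1} (vee_map l m f) (vee_map m n g) j \<in> {0..l - 1}"
      using vee_map_range[OF f lm(1) vg] j by (simp only: compose_eq)
    show "i \<le> vee_map l n (compose {0..l} g f) j \<longleftrightarrow>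
        i \<le> compose {0..n - 1} (vee_map l m f) (vee_map m n g) j" if "i \<in> {0..l - 1}" for i
    proof -
      have i: "i \<in> {0..l}" using that by auto
      have fi: "f i \<in> {0..m}" using ordinal_mapsD(1)[OF interval_mapsD(1)[OF f] i] .
      have "i \<le> vee_map l n (compose {0..l} g f) j \<longleftrightarrow> g (f i) \<le> j"
        using le_vee_map_iff[OF gf i j] i by (simp only: compose_eq)
      also have "\<dots> \<longleftrightarrow> f i \<le> vee_map m n g j" using le_vee_map_iff[OF g fi j] by simp
      also have "\<dots> \<longleftrightarrow> i \<le> vee_map l m f (vee_map m n g j)"
        using le_vee_map_iff[OF f i vg] by simp
      finally show ?thesis using j by (simp only: compose_eq)
    qed
  qed
qed (auto simp: vee_map_def)


section \<open>The category of iterated intervals\<close>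

lemma ITriv_in_iI_obj: "ITriv \<in> iI_obj"
  unfolding iI_obj_def using iI_height.triv by blast

text \<open>
  This and its counterpart \<open>DNode_in_iD_obj_iff\<close> remove heights from all later arguments: a
  node has finitely many components, so their heights are bounded as soon as each component has
  one.
\<close>

lemma INode_in_iI_obj_iff:
  "INode m H \<in> iI_obj \<longleftrightarrow> 1 \<le> m \<and> H \<in> extensional {0..m} \<and> (\<forall>i\<in>{0..m}. H i \<in> iI_obj) \<and>
     (\<forall>i\<in>{0..m}. H i = ITriv \<longleftrightarrow> i = 0 \<or> i = m)" (is "_ \<longleftrightarrow> ?R")
proof
  assume "INode m H \<in> iI_obj"
  then obtain n where "iI_height n (INode m H)" unfolding iI_obj_def by blast
  then show ?R by cases (auto simp: iI_obj_def)
next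
  assume R: ?R
  then obtain h where h: "\<forall>i\<in>{0..m}. iI_height (h i) (H i)"
    unfolding iI_obj_def by (auto dest!: bchoice)
  have "h i < Suc (Max (h ` {0..m}))" if "i \<in> {0..m}" for i
    using that by (simp add: less_Suc_eq_le)
  then have "iI_height (Suc (Max (h ` {0..m}))) (INode m H)"
    using R h by (intro iI_height.node) (simp_all del: atLeastAtMost_iff, blast)
  then show "INode m H \<in> iI_obj" unfolding iI_obj_def by blast
qed

lemma iI_hom_ends:
  assumes "iI_hom H K f"
  shows "H \<in> iI_obj" "K \<in> iI_obj" "iI_dom f = H" "iI_cod f = K"
  using assms by (induction rule: iI_hom.induct) (auto simp: ITriv_in_iI_obj)

lemma iI_hom_id: "H \<in> iI_obj \<Longrightarrow> iI_hom H H (iI_id H)"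
proof (induction H)
  case ITriv
  then show ?case by (auto intro: iI_hom.bang)
next
  case (INode m H)
  then have "1 \<le> m" "\<forall>i\<in>{0..m}. iI_hom (H i) (H i) (iI_id (H i))"
    by (auto simp: INode_in_iI_obj_iff)
  with INode.prems show ?case
    by (auto intro!: iI_hom.mor simp del: atLeastAtMost_iff simp: id_in_interval_maps)
qed

lemma iI_hom_comp:
  assumes "iI_hom K L g" "iI_hom H K f"
  shows "iI_hom H L (iI_comp g f)"
  using assms
proof (induction arbitrary: H f rule: iI_hom.induct)
  case (bang K)
  then show ?case by (auto simp: iI_hom_ends intro!: iI_hom.bang)
next
  case (mor m K n L g gs)
  from mor.prems show ?case
  proof cases
    case (mor l H' f' fs)
    note f = mor
    have l: "0 \<le> l" using f(3) by (simp add: INode_in_iI_obj_iff)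
    have "f' i \<in> {0..m}" if "i \<in> {0..l}" for i
      using that f(5) interval_mapsD(1) ordinal_mapsD(1) by blast
    with mor.IH mor.hyps f l show ?thesis
      by (auto intro!: iI_hom.mor compose_in_interval_maps simp del: atLeastAtMost_iff
          simp: compose_eq)
  qed
qed

lemma iI_comp_id_right:
  assumes "iI_hom H K f"
  shows "iI_comp f (iI_id H) = f"
  using assms
proof (induction rule: iI_hom.induct)
  case (bang H)
  then show ?case using iI_hom_ends[OF iI_hom_id] by simp
next
  case (mor m H n K g gs)
  have "compose {0..m} g (\<lambda>i\<in>{0..m}. i) = g"
    using ordinal_mapsD(3)[OF interval_mapsD(1)[OF mor.hyps(3)]]
    by (auto simp: fun_eq_iff compose_def extensional_def)
  with mor show ?case by (auto simp: fun_eq_iff extensional_def)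
qed

lemma iI_comp_id_left:
  assumes "iI_hom H K f"
  shows "iI_comp (iI_id K) f = f"
  using assms
proof (induction rule: iI_hom.induct)
  case (bang H)
  then show ?case by simp
next
  case (mor m H n K g gs)
  have g: "g i \<in> {0..n}" if "i \<in> {0..m}" for i
    using ordinal_mapsD(1)[OF interval_mapsD(1)[OF mor.hyps(3)] that] .
  have "compose {0..m} (\<lambda>i\<in>{0..n}. i) g = g"
    using ordinal_mapsD(3)[OF interval_mapsD(1)[OF mor.hyps(3)]] g
    by (auto simp: fun_eq_iff compose_def extensional_def)
  with mor g show ?case by (auto simp: fun_eq_iff extensional_def)
qed

lemma iI_comp_assoc:
  assumes "iI_hom J L h" "iI_hom K J g" "iI_hom H K f"
  shows "iI_comp h (iI_comp g f) = iI_comp (iI_comp h g) f"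
  using assms
proof (induction arbitrary: H K g f rule: iI_hom.induct)
  case (bang J)
  then show ?case using iI_hom_ends[OF iI_hom_comp[OF bang(2,3)]] iI_hom_ends[OF bang(2)]
      iI_hom_ends[OF bang(3)] by simp
next
  case outer: (mor m J n L h hs)
  from outer.prems(1) show ?case
  proof cases
    case (mor k K' g' gs)
    note g = this
    from outer.prems(2)[unfolded g(1)] show ?thesis
    proof cases
      case (mor l H' f' fs)
      note f = this
      have f': "f' i \<in> {0..k}" if "i \<in> {0..l}" for i
        using that f interval_mapsD(1) ordinal_mapsD(1) by blast
      have g': "g' i \<in> {0..m}" if "i \<in> {0..k}" for i
        using that g interval_mapsD(1) ordinal_mapsD(1) by blast
      have "iI_comp (hs (g' (f' i))) (iI_comp (gs (f' i)) (fs i)) =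
          iI_comp (iI_comp (hs (g' (f' i))) (gs (f' i))) (fs i)" if "i \<in> {0..l}" for i
        using outer.IH f' g' f g that by blast
      then show ?thesis
        using f g f' by (auto simp: fun_eq_iff compose_def)
    qed
  qed
qed

lemma is_category_iI_cat: "is_category iI_cat"
proof -
  have arr: "f \<in> Arr iI_cat \<longleftrightarrow> iI_hom (iI_dom f) (iI_cod f) f" for f
  proof
    assume "f \<in> Arr iI_cat"
    then obtain H K where f: "iI_hom H K f" by (auto simp: iI_cat_def)
    then show "iI_hom (iI_dom f) (iI_cod f) f" using iI_hom_ends[OF f] by simp
  qed (auto simp: iI_cat_def)
  have sel: "Obj iI_cat = iI_obj" "Dom iI_cat = iI_dom" "Cod iI_cat = iI_cod"
    "Ident iI_cat = iI_id" "Comp iI_cat = iI_comp"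
    by (simp_all add: iI_cat_def)
  have ident: "iI_hom (iI_dom (iI_id H)) (iI_cod (iI_id H)) (iI_id H) \<and>
      iI_dom (iI_id H) = H \<and> iI_cod (iI_id H) = H" if "H \<in> iI_obj" for H
    using iI_hom_id[OF that] iI_hom_ends[OF iI_hom_id[OF that]] by simp
  have comp: "iI_hom (iI_dom (iI_comp g f)) (iI_cod (iI_comp g f)) (iI_comp g f) \<and>
      iI_dom (iI_comp g f) = iI_dom f \<and> iI_cod (iI_comp g f) = iI_cod g"
    if g: "iI_hom (iI_dom g) (iI_cod g) g" and f: "iI_hom (iI_dom f) (iI_cod f) f"
      and "iI_dom g = iI_cod f" for g f
  proof -
    have gf: "iI_hom (iI_dom f) (iI_cod g) (iI_comp g f)"
      by (rule iI_hom_comp[OF g]) (use f that(3) in simp)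
    then show ?thesis using iI_hom_ends[OF gf] by simp
  qed
  have assoc: "iI_comp h (iI_comp g f) = iI_comp (iI_comp h g) f"
    if h: "iI_hom (iI_dom h) (iI_cod h) h" and g: "iI_hom (iI_dom g) (iI_cod g) g"
      and f: "iI_hom (iI_dom f) (iI_cod f) f"
      and "iI_dom h = iI_cod g" "iI_dom g = iI_cod f" for h g f
    by (rule iI_comp_assoc[OF h, of "iI_dom g" _ "iI_dom f"]) (use g f that(4,5) in simp_all)
  have objs: "iI_dom f \<in> iI_obj \<and> iI_cod f \<in> iI_obj"
    if "iI_hom (iI_dom f) (iI_cod f) f" for f
    using iI_hom_ends(1,2)[OF that] ..
  have unit: "iI_comp f (iI_id (iI_dom f)) = f \<and> iI_comp (iI_id (iI_cod f)) f = f"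
    if "iI_hom (iI_dom f) (iI_cod f) f" for f
    using iI_comp_id_right[OF that] iI_comp_id_left[OF that] ..
  show ?thesis
    unfolding is_category_def Ball_def arr sel
    \<comment> \<open>the instance of \<open>conjI\<close> splits the five laws but not the conjunctions inside them\<close>
    by (intro conjI[of "All _"] allI impI; (rule objs ident comp unit assoc; assumption))
qed


section \<open>Duality of iterated ordinals and iterated intervals\<close>

lemma DTriv_in_iD_obj: "DTriv \<in> iD_obj"
  unfolding iD_obj_def using iD_height.triv by blast

lemma DNode_in_iD_obj_iff:
  "DNode m K \<in> iD_obj \<longleftrightarrow> 0 \<le> m \<and> K \<in> extensional {0..m + 1} \<and>
     (\<forall>j\<in>{0..m + 1}. K j \<in> iD_obj) \<and>
     (\<forall>j\<in>{0..m + 1}. K j = DTriv \<longleftrightarrow> j = 0 \<or> j = m + 1)" (is "_ \<longleftrightarrow> ?R")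
proof
  assume "DNode m K \<in> iD_obj"
  then obtain n where "iD_height n (DNode m K)" unfolding iD_obj_def by blast
  then show ?R by cases (auto simp: iD_obj_def)
next
  assume R: ?R
  then obtain h where h: "\<forall>i\<in>{0..m + 1}. iD_height (h i) (K i)"
    unfolding iD_obj_def by (auto dest!: bchoice)
  have "h i < Suc (Max (h ` {0..m + 1}))" if "i \<in> {0..m + 1}" for i
    using that by (simp add: less_Suc_eq_le)
  then have "iD_height (Suc (Max (h ` {0..m + 1}))) (DNode m K)"
    using R h by (intro iD_height.node) (simp_all del: atLeastAtMost_iff, blast)
  then show "DNode m K \<in> iD_obj" unfolding iD_obj_def by blast
qed

lemma iD_hom_ends:
  assumes "iD_hom H K f"
  shows "H \<in> iD_obj" "K \<in> iD_obj" "iD_dom f = H" "iD_cod f = K"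
  using assms by (induction rule: iD_hom.induct) (auto simp: DTriv_in_iD_obj)

lemma vee_obj_eq_DTriv_iff: "vee_obj H = DTriv \<longleftrightarrow> H = ITriv"
  by (cases H) auto

lemma wedge_obj_eq_ITriv_iff: "wedge_obj K = ITriv \<longleftrightarrow> K = DTriv"
  by (cases K) auto

lemma vee_obj_in_iD_obj: "H \<in> iI_obj \<Longrightarrow> vee_obj H \<in> iD_obj"
  by (induction H)
    (auto simp: DTriv_in_iD_obj INode_in_iI_obj_iff DNode_in_iD_obj_iff vee_obj_eq_DTriv_iff)

lemma wedge_obj_in_iI_obj: "K \<in> iD_obj \<Longrightarrow> wedge_obj K \<in> iI_obj"
  by (induction K)
    (auto simp: ITriv_in_iI_obj INode_in_iI_obj_iff DNode_in_iD_obj_iff wedge_obj_eq_ITriv_iff)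

lemma wedge_vee_obj: "H \<in> iI_obj \<Longrightarrow> wedge_obj (vee_obj H) = H"
  by (induction H) (auto simp: INode_in_iI_obj_iff extensional_def fun_eq_iff)

lemma vee_wedge_obj: "K \<in> iD_obj \<Longrightarrow> vee_obj (wedge_obj K) = K"
  by (induction K) (auto simp: DNode_in_iD_obj_iff extensional_def fun_eq_iff)

text \<open>
  The component of the dual at \<open>i\<close> starts at \<open>vee_obj (K ((g\<^sup>\<or>)\<^sup>\<and> i))\<close>, which is
  \<open>vee_obj (K (g i))\<close> by \<open>wedge_vee_map\<close>.
\<close>

lemma iD_hom_vee_arr:
  assumes "iI_hom H K f"
  shows "iD_hom (vee_obj K) (vee_obj H) (vee_arr f)"
  using assms
proof (induction rule: iI_hom.induct)
  case (bang H)
  then show ?case by (auto intro!: iD_hom.bang vee_obj_in_iD_obj)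
next
  case (mor m H n K g gs)
  have mn: "1 \<le> m" "1 \<le> n" using mor.hyps by (auto simp: INode_in_iI_obj_iff)
  have "g i \<in> {0..n}" if "i \<in> {0..m}" for i
    using ordinal_mapsD(1)[OF interval_mapsD(1)[OF mor.hyps(3)] that] .
  moreover have "wedge_map (n - 1) (m - 1) (vee_map m n g) = g"
    using wedge_vee_map[OF mor.hyps(3)] mn .
  moreover have "vee_map m n g \<in> ordinal_maps (n - 1) (m - 1)"
    using vee_map_in_ordinal_maps[OF mor.hyps(3)] mn by simp
  ultimately show ?case
    using mor vee_obj_in_iD_obj[OF mor.hyps(1)] vee_obj_in_iD_obj[OF mor.hyps(2)]
    by (auto intro!: iD_hom.mor simp del: atLeastAtMost_iff)
qed

lemma iI_hom_wedge_arr: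
  assumes "iD_hom H K f"
  shows "iI_hom (wedge_obj K) (wedge_obj H) (wedge_arr f)"
  using assms
proof (induction rule: iD_hom.induct)
  case (bang K)
  then show ?case by (auto intro!: iI_hom.bang wedge_obj_in_iI_obj)
next
  case (mor m H n K g gs)
  have mn: "0 \<le> m" "0 \<le> n" using mor.hyps by (auto simp: DNode_in_iD_obj_iff)
  have "wedge_map m n g j \<in> {0..m + 1}" if "j \<in> {0..n + 1}" for j
    using wedge_map_range[OF mn(1) that] .
  moreover have "wedge_map m n g \<in> interval_maps (n + 1) (m + 1)"
    using wedge_map_in_interval_maps[OF mor.hyps(3) mn] .
  ultimately show ?case
    using mor wedge_obj_in_iI_obj[OF mor.hyps(1)] wedge_obj_in_iI_obj[OF mor.hyps(2)]
    by (auto intro!: iI_hom.mor simp del: atLeastAtMost_iff)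
qed

lemma iD_under_vee_obj: "iD_under (vee_obj H) = iI_under H - 1"
  by (cases H) auto

lemma iI_under_wedge_obj: "iI_under (wedge_obj K) = iD_under K + 1"
  by (cases K) auto

lemma wedge_vee_arr:
  assumes "iI_hom H K f"
  shows "wedge_arr (vee_arr f) = f"
  using assms
proof (induction rule: iI_hom.induct)
  case (bang H)
  then show ?case by (simp add: wedge_vee_obj)
next
  case (mor m H n K g gs)
  then have "wedge_map (n - 1) (m - 1) (vee_map m n g) = g"
    by (intro wedge_vee_map) (auto simp: INode_in_iI_obj_iff)
  with mor wedge_vee_obj[OF mor.hyps(1)] wedge_vee_obj[OF mor.hyps(2)] show ?case
    by (auto simp: extensional_def fun_eq_iff)
qed

lemma vee_wedge_arr:
  assumes "iD_hom H K f"
  shows "vee_arr (wedge_arr f) = f"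
  using assms
proof (induction rule: iD_hom.induct)
  case (bang K)
  then show ?case by (simp add: vee_wedge_obj)
next
  case (mor m H n K g gs)
  then have "vee_map (n + 1) (m + 1) (wedge_map m n g) = g"
    by (intro vee_wedge_map) (auto simp: DNode_in_iD_obj_iff)
  with mor vee_wedge_obj[OF mor.hyps(1)] vee_wedge_obj[OF mor.hyps(2)] show ?case
    by (auto simp: extensional_def fun_eq_iff)
qed

lemma vee_arr_id: "H \<in> iI_obj \<Longrightarrow> vee_arr (iI_id H) = iD_id (vee_obj H)"
  by (induction H) (auto simp: INode_in_iI_obj_iff vee_map_id fun_eq_iff)

text \<open>
  The composite of the duals pairs the component of \<open>vee_arr f\<close> at \<open>i\<close> with that of \<open>vee_arr g\<close>
  at \<open>(f\<^sup>\<or>)\<^sup>\<and> i = f i\<close>, as the composite of \<open>g\<close> and \<open>f\<close> does.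
\<close>

lemma vee_arr_comp:
  assumes "iI_hom K L g" "iI_hom H K f"
  shows "vee_arr (iI_comp g f) = iD_comp (vee_arr f) (vee_arr g)"
  using assms
proof (induction arbitrary: H f rule: iI_hom.induct)
  case (bang K)
  from bang.prems show ?case by cases auto
next
  case outer: (mor m K n L g gs)
  from outer.prems show ?case
  proof cases
    case (mor l H' f' fs)
    note f = this
    have lmn: "1 \<le> l" "1 \<le> m" "1 \<le> n" using f(3) outer.hyps by (auto simp: INode_in_iI_obj_iff)
    have f': "f' i \<in> {0..m}" if "i \<in> {0..l}" for i
      using that f interval_mapsD(1) ordinal_mapsD(1) by blast
    have "wedge_map (m - 1) (l - 1) (vee_map l m f') = f'"
      using f lmn by (intro wedge_vee_map) auto
    moreover have "vee_map l n (compose {0..l} g f') =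
        compose {0..n - 1} (vee_map l m f') (vee_map m n g)"
      using f outer.hyps lmn by (intro vee_map_compose) auto
    moreover have "vee_arr (iI_comp (gs (f' i)) (fs i)) =
        iD_comp (vee_arr (fs i)) (vee_arr (gs (f' i)))" if "i \<in> {0..l}" for i
      using outer.IH f f' that by blast
    ultimately show ?thesis
      using f f' by (auto simp: fun_eq_iff)
  qed
qed

theorem theorem3p4:
  "inverse_isomorphisms (opposite iI_cat) iD_cat vee wedge \<and>
   inverse_isomorphisms (opposite iD_cat) iI_cat wedge vee"
proof -
  have "inverse_isomorphisms (opposite iI_cat) iD_cat vee wedge"
  proof (rule inverse_isomorphisms_by_transport)
    show "is_category (opposite iI_cat)"
      by (rule is_category_opposite[OF is_category_iI_cat])
    show "on_arr vee (Comp (opposite iI_cat) g f) = Comp iD_cat (on_arr vee g) (on_arr vee f)"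
      if "g \<in> Arr (opposite iI_cat)" "f \<in> Arr (opposite iI_cat)"
        "Dom (opposite iI_cat) g = Cod (opposite iI_cat) f" for g f
      using that vee_arr_comp iI_hom_ends
      by (auto simp: opposite_def iI_cat_def iD_cat_def vee_def)
  qed (auto simp: opposite_def iI_cat_def iD_cat_def vee_def wedge_def vee_arr_id
      vee_obj_in_iD_obj wedge_obj_in_iI_obj wedge_vee_obj vee_wedge_obj
      wedge_vee_arr vee_wedge_arr iI_hom_ends iD_hom_ends[OF iD_hom_vee_arr]
      intro: iD_hom_vee_arr iI_hom_wedge_arr)
  then show ?thesis
    using inverse_isomorphisms_opposite by blast
qed

end
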